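(* For every $(X,\Omega)$-decorated planar rooted forest $F\in\mathcal{F}_{\rm RT}(X,\Omega)$, one has $$\Delta_{\rm RT}(F)=\sum_{G\in\mathcal{F}_F} G\otimes \widetilde{F/G},$$ where $\mathcal{F}_F$ is the set of subforests of $F$ (including the empty one and $F$ itself), $F/G$ is the quotient forest, and $\widetilde{F/G}=\Phi(F/G)$ is obtained from $F/G$ by applying the leaf-shift operator $\Phi$.
   Context: Let $\mathbf{k}$ be a unitary commutative ring, $X$ a set, $\Omega$ a nonempty set disjoint from $X$, and fix maps $\mu:X\to\mathbf{k}$, $x\mapsto\mu_x$, and $\lambda:\Omega\to\mathbf{k}$, $\omega\mapsto\lambda_\omega$. Decorated forests. An $(X,\Omega)$-decorated rooted tree is a (nonempty) planar rooted tree whose internal (non-leaf) vertices are decorated by elements of $\Omega$ and whose leaf vertices are decorated by elements of $X\sqcup\Omega$; the only vertex of a one-vertex tree is regarded as a leaf. $\mathcal{T}_{\rm RT}(X,\Omega)$ is the set of such trees, and $\mathcal{F}_{\rm RT}(X,\Omega)$ (the forests) is the free monoid on $\mathcal{T}_{\rm RT}(X,\Omega)$ under concatenation, with unit the empty forest $1$. $H_{\rm RT}(X,\Omega)=\mathbf{k}\mathcal{F}_{\rm RT}(X,\Omega)$ is the free $\mathbf{k}$-module on the forests, a unitary associative algebra under concatenation. For $a\in X\sqcup\Omega$, $\bullet_a$ is the one-vertex tree decorated by $a$. For $\omega\in\Omega$, $B^+_\omega:H_{\rm RT}(X,\Omega)\to H_{\rm RT}(X,\Omega)$ is the linear grafting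 operator: $B^+_\omega(1)=\bullet_\omega$, and $B^+_\omega(T_1\cdots T_n)$ is the tree obtained by joining the roots of $T_1,\dots,T_n$ (in order) to a new root decorated by $\omega$. Every tree is uniquely either $\bullet_x$ with $x\in X$ or $B^+_\omega(\overline{F})$ with $\omega\in\Omega$, $\overline{F}$ a forest. Coproduct. The linear map $\Delta_{\rm RT}:H_{\rm RT}(X,\Omega)\to H_{\rm RT}(X,\Omega)\otimes H_{\rm RT}(X,\Omega)$ is defined recursively by $\Delta_{\rm RT}(1)=1\otimes 1$; $\Delta_{\rm RT}(\bullet_x)=\bullet_x\otimes 1+1\otimes\bullet_x+\mu_x\,1\otimes 1$ for $x\in X$; $\Delta_{\rm RT}(B^+_\omega(\overline{F}))=B^+_\omega(\overline{F})\otimes 1+(\mathrm{id}\otimes B^+_\omega)\Delta_{\rm RT}(\overline{F})+\lambda_\omega\overline{F}\otimes 1$; and $\Delta_{\rm RT}(T_1\cdots T_m)=\Delta_{\rm RT}(T_1)\cdots\Delta_{\rm RT}(T_m)$ for $m\ge 2$ trees. Subforests and quotients. A subforest $G$ of a forest $F$ consists of a set of vertices of $F$ together with all their descendants and the edges connecting all these vertices (so subforests correspond to descendant-closed subsets of vertices of $F$, and distinct subsets are counted as distinct subforests); it is regarded as a decorated planar forest with the induced left-to-right order. The empty forest $1$ and $F$ are included. The quotient $F/G$ is obtained by removing from $F$ the subforest $G$ and the edges connecting it to the rest of $F$; so $F/F=1$ and $F/1=F$. Leaf-shift operator. $\Phi:H_{\rm RT}(X,\Omega)\to H_{\rm RT}(X,\Omega)$,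 $F\mapsto\widetilde{F}$, is the linear map obtained by replacing each leaf vertex $\bullet_x$ ($x\in X$) of $F$ by $\bullet_x+\mu_x$ and each leaf vertex $\bullet_\omega$ ($\omega\in\Omega$) of $F$ by $\bullet_\omega+\lambda_\omega$, and expanding multilinearly, where replacing a leaf by the scalar means deleting that leaf (and the edge to its parent) and multiplying by the scalar. Only the leaves of the original $F$ are affected (vertices that become leaves after deletion are not modified), and $\widetilde{1}=1$. *)

theory Defs
  imports
    Complex_Main
    "HOL-Library.Poly_Mapping"
    "HOL-Library.Product_Plus"
    "HOL-Library.Sublist"
begin

section \<open>Decorated planar rooted forests\<close>

text \<open>
  \<open>Leaf x\<close> is the one-vertex tree decorated by \<open>x \<in> X\<close>, and \<open>Node \<omega> F\<close> is the grafting
  \<open>B\<^sup>+\<^sub>\<omega>(F)\<close>; in particular \<open>Node \<omega> []\<close> is the one-vertex tree decorated by \<open>\<omega> \<in> \<Omega>\<close>.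
  Using two constructors makes the sets \<open>X\<close> and \<open>\<Omega>\<close> of decorations disjoint.
\<close>

datatype (X_decs: 'x, Omega_decs: 'w) rtree =
  Leaf 'x
| Node 'w "('x, 'w) rtree list"

type_synonym ('x, 'w) forest = "('x, 'w) rtree list"

definition F_RT :: "'x set \<Rightarrow> 'w set \<Rightarrow> ('x, 'w) forest set" where
  "F_RT X \<Omega> = {F. \<forall>T \<in> set F. X_decs T \<subseteq> X \<and> Omega_decs T \<subseteq> \<Omega>}"

primrec children :: "('x, 'w) rtree \<Rightarrow> ('x, 'w) forest" where
  "children (Leaf x) = []"
| "children (Node \<omega> F) = F"

lemma size_children_less: "size_list size (children T) < size T"
  by (cases T) auto

lemma size_list_children_nth:
  assumes "i < length F"
  shows "size_list size (children (F ! i)) < size_list size F"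
proof -
  have "size (F ! i) \<le> size_list size F"
    using assms by (intro size_list_estimation'[of "F ! i"]) auto
  then show ?thesis
    using size_children_less[of "F ! i"] by linarith
qed


section \<open>Free modules and tensor products\<close>

text \<open>
  The free \<open>\<k>\<close>-module on a set is the type \<open>'a \<Rightarrow>\<^sub>0 'k\<close> of finitely supported functions. The library
  makes it an algebra (with the convolution product) when the basis is a monoid written additively,
  so concatenation of lists is registered as a (noncommutative) addition; the unit of the algebra
  on forests is then the empty forest. The free module on pairs models the tensor product of two
  free modules (see the universal property \<open>tensor_universal\<close> below), and the componentwise
  addition of pairs gives the usual product \<open>(a \<otimes> b)(c \<otimes> d) = ac \<otimes> bd\<close>
  (\<open>tensor_mult\<close>).
\<close>

instantiation list :: (type) monoid_add
begin

definition zero_list :: "'a list" where "zero_list = []"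

definition plus_list :: "'a list \<Rightarrow> 'a list \<Rightarrow> 'a list" where "plus_list xs ys = xs @ ys"

instance
  by standard (auto simp: zero_list_def plus_list_def)

end

definition basis :: "'a \<Rightarrow> ('a \<Rightarrow>\<^sub>0 'k::comm_ring_1)" where
  "basis a = Poly_Mapping.single a 1"

definition scale :: "'k \<Rightarrow> ('a \<Rightarrow>\<^sub>0 'k) \<Rightarrow> ('a \<Rightarrow>\<^sub>0 'k::comm_ring_1)" where
  "scale c p = Poly_Mapping.map (\<lambda>d. c * d) p"

definition lin_ext :: "('a \<Rightarrow> ('b \<Rightarrow>\<^sub>0 'k)) \<Rightarrow> ('a \<Rightarrow>\<^sub>0 'k) \<Rightarrow> ('b \<Rightarrow>\<^sub>0 'k::comm_ring_1)" where
  "lin_ext f p = (\<Sum>a \<in> Poly_Mapping.keys p. scale (Poly_Mapping.lookup p a) (f a))"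

definition tensor ::
    "('a \<Rightarrow>\<^sub>0 'k) \<Rightarrow> ('b \<Rightarrow>\<^sub>0 'k) \<Rightarrow> ('a \<times> 'b \<Rightarrow>\<^sub>0 'k::comm_ring_1)" (infixr "\<otimes>" 75) where
  "p \<otimes> q = (\<Sum>a \<in> Poly_Mapping.keys p. \<Sum>b \<in> Poly_Mapping.keys q.
      Poly_Mapping.single (a, b) (Poly_Mapping.lookup p a * Poly_Mapping.lookup q b))"

definition tensor_map ::
    "(('a \<Rightarrow>\<^sub>0 'k) \<Rightarrow> ('c \<Rightarrow>\<^sub>0 'k)) \<Rightarrow> (('b \<Rightarrow>\<^sub>0 'k) \<Rightarrow> ('d \<Rightarrow>\<^sub>0 'k)) \<Rightarrow>
     ('a \<times> 'b \<Rightarrow>\<^sub>0 'k) \<Rightarrow> ('c \<times> 'd \<Rightarrow>\<^sub>0 'k::comm_ring_1)" where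
  "tensor_map f g = lin_ext (\<lambda>(a, b). f (basis a) \<otimes> g (basis b))"

type_synonym ('x, 'w, 'k) H_RT = "('x, 'w) forest \<Rightarrow>\<^sub>0 'k"

type_synonym ('x, 'w, 'k) H_RT2 = "('x, 'w) forest \<times> ('x, 'w) forest \<Rightarrow>\<^sub>0 'k"

lemma one_H_RT: "(1 :: ('x, 'w, 'k::comm_ring_1) H_RT) = basis []"
  by (simp add: basis_def zero_list_def flip: single_one)

lemma basis_mult: "basis F * basis G = (basis (F @ G) :: ('x, 'w, 'k::comm_ring_1) H_RT)"
  by (simp add: basis_def mult_single plus_list_def)

lemma lookup_scale [simp]:
  "Poly_Mapping.lookup (scale c p) a = c * Poly_Mapping.lookup p a"
  by (simp add: scale_def map.rep_eq when_def)

lemma module_scale: "module (scale :: 'k::comm_ring_1 \<Rightarrow> ('a \<Rightarrow>\<^sub>0 'k) \<Rightarrow> _)"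
  by standard (auto intro!: poly_mapping_eqI simp: lookup_add algebra_simps)

lemma lookup_tensor:
  "Poly_Mapping.lookup (p \<otimes> q) (a, b) = Poly_Mapping.lookup p a * Poly_Mapping.lookup q b"
proof -
  have "Poly_Mapping.lookup (p \<otimes> q) (a, b) =
      (\<Sum>a' \<in> Poly_Mapping.keys p. \<Sum>b' \<in> Poly_Mapping.keys q.
        if a' = a then (if b' = b then Poly_Mapping.lookup p a' * Poly_Mapping.lookup q b' else 0)
        else 0)"
    unfolding tensor_def lookup_sum
    by (intro sum.cong refl) (auto simp: lookup_single when_def)
  also have "\<dots> = (\<Sum>a' \<in> Poly_Mapping.keys p.
        if a' = a then (\<Sum>b' \<in> Poly_Mapping.keys q.
          if b' = b then Poly_Mapping.lookup p a' * Poly_Mapping.lookup q b' else 0) else 0)"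
    by (intro sum.cong refl) auto
  also have "\<dots> = Poly_Mapping.lookup p a * Poly_Mapping.lookup q b"
    by (auto simp: sum.delta in_keys_iff)
  finally show ?thesis .
qed

lemma tensor_basis: "basis a \<otimes> basis b = (basis (a, b) :: _ \<Rightarrow>\<^sub>0 'k::comm_ring_1)"
  by (simp add: tensor_def basis_def)

lemma sum_scale_basis:
  "p = (\<Sum>a \<in> Poly_Mapping.keys p. scale (Poly_Mapping.lookup p a) (basis a))"
  by (rule poly_mapping_eqI)
     (auto simp: lookup_sum basis_def lookup_single when_def in_keys_iff if_distrib sum.delta
           cong: if_cong)

lemma lin_ext_basis [simp]: "lin_ext f (basis a) = f a"
  by (auto intro!: poly_mapping_eqI simp: lin_ext_def basis_def)

lemma lin_ext_module_hom:
  "module_hom (scale :: 'k::comm_ring_1 \<Rightarrow> _) scale (lin_ext f)"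
proof -
  interpret m: module "scale :: 'k \<Rightarrow> ('b \<Rightarrow>\<^sub>0 'k) \<Rightarrow> _"
    by (rule module_scale)
  have superset: "lin_ext f p = (\<Sum>a \<in> A. scale (Poly_Mapping.lookup p a) (f a))"
    if "finite A" "Poly_Mapping.keys p \<subseteq> A" for p A
    unfolding lin_ext_def using that
    by (intro sum.mono_neutral_left) (auto simp: in_keys_iff)
  have "lin_ext f (p + q) = lin_ext f p + lin_ext f q" for p q
  proof -
    let ?A = "Poly_Mapping.keys p \<union> Poly_Mapping.keys q"
    have "Poly_Mapping.keys (p + q) \<subseteq> ?A"
      by (rule Poly_Mapping.keys_add)
    then show ?thesis
      by (simp add: superset[of ?A] lookup_add m.scale_left_distrib sum.distrib)
  qed
  moreover have "lin_ext f (scale c p) = scale c (lin_ext f p)" for c p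
  proof -
    have "Poly_Mapping.keys (scale c p) \<subseteq> Poly_Mapping.keys p"
      by (auto simp: in_keys_iff)
    then show ?thesis
      by (simp add: superset[of "Poly_Mapping.keys p"] m.scale_sum_right)
  qed
  ultimately show ?thesis
    by (simp add: module_hom_iff module_scale)
qed

lemma tensor_universal:
  fixes s :: "'k::comm_ring_1 \<Rightarrow> 'm::ab_group_add \<Rightarrow> 'm"
    and \<beta> :: "('a \<Rightarrow>\<^sub>0 'k) \<Rightarrow> ('b \<Rightarrow>\<^sub>0 'k) \<Rightarrow> 'm"
  assumes left: "\<And>q. module_hom scale s (\<lambda>p. \<beta> p q)"
    and right: "\<And>p. module_hom scale s (\<beta> p)"
  shows "\<exists>!L. module_hom scale s L \<and> (\<forall>p q. L (p \<otimes> q) = \<beta> p q)"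
proof -
  interpret ms: module s using left by (simp add: module_hom_iff)
  interpret l: module_hom scale s "\<lambda>p. \<beta> p q" for q by (rule left)
  interpret r: module_hom scale s "\<beta> p" for p by (rule right)
  interpret t: module "scale :: 'k \<Rightarrow> ('a \<times> 'b \<Rightarrow>\<^sub>0 'k) \<Rightarrow> _" by (rule module_scale)
  define L where "L t = (\<Sum>(a, b) \<in> Poly_Mapping.keys t.
    s (Poly_Mapping.lookup t (a, b)) (\<beta> (basis a) (basis b)))" for t
  have superset: "L t = (\<Sum>(a, b) \<in> A. s (Poly_Mapping.lookup t (a, b)) (\<beta> (basis a) (basis b)))"
    if "finite A" "Poly_Mapping.keys t \<subseteq> A" for t A
    unfolding L_def using that
    by (intro sum.mono_neutral_left) (auto simp: in_keys_iff)
  have L_add: "L (t + u) = L t + L u" for t u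
  proof -
    let ?A = "Poly_Mapping.keys t \<union> Poly_Mapping.keys u"
    have "Poly_Mapping.keys (t + u) \<subseteq> ?A"
      by (rule Poly_Mapping.keys_add)
    then show ?thesis
      by (simp add: superset[of ?A] lookup_add ms.scale_left_distrib sum.distrib case_prod_unfold)
  qed
  have L_scale: "L (scale c t) = s c (L t)" for c t
  proof -
    have "Poly_Mapping.keys (scale c t) \<subseteq> Poly_Mapping.keys t"
      by (auto simp: in_keys_iff)
    then show ?thesis
      by (simp add: superset[of "Poly_Mapping.keys t"] ms.scale_sum_right case_prod_unfold)
  qed
  have L_hom: "module_hom scale s L"
    unfolding module_hom_iff
    using L_add L_scale module_scale ms.module_axioms by blast
  have L_tensor: "L (p \<otimes> q) = \<beta> p q" for p q
  proof -
    let ?A = "Poly_Mapping.keys p" and ?B = "Poly_Mapping.keys q"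
    have keys: "Poly_Mapping.keys (p \<otimes> q) \<subseteq> ?A \<times> ?B"
      by (auto simp: in_keys_iff lookup_tensor)
    have "\<beta> p q = \<beta> (\<Sum>a \<in> ?A. scale (Poly_Mapping.lookup p a) (basis a))
                    (\<Sum>b \<in> ?B. scale (Poly_Mapping.lookup q b) (basis b))"
      by (simp flip: sum_scale_basis)
    also have "\<dots> = (\<Sum>a \<in> ?A. \<Sum>b \<in> ?B.
        s (Poly_Mapping.lookup p a * Poly_Mapping.lookup q b) (\<beta> (basis a) (basis b)))"
      by (simp add: l.sum r.sum l.scale r.scale ms.scale_sum_right ms.scale_scale)
         (rule trans[OF sum.swap], simp add: mult.commute)
    also have "\<dots> = L (p \<otimes> q)"
      by (simp add: superset[OF _ keys] lookup_tensor sum.cartesian_product)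
    finally show ?thesis by simp
  qed
  show ?thesis
  proof (intro ex1I[of _ L] conjI allI L_hom L_tensor)
    fix L' assume L': "module_hom scale s L' \<and> (\<forall>p q. L' (p \<otimes> q) = \<beta> p q)"
    then interpret L': module_hom scale s L' by blast
    interpret L: module_hom scale s L by (rule L_hom)
    have eq: "L' (basis ab) = L (basis ab)" for ab
      using L' L_tensor by (cases ab) (simp flip: tensor_basis)
    have "L' t = L t" for t
    proof -
      let ?e = "\<Sum>ab \<in> Poly_Mapping.keys t. scale (Poly_Mapping.lookup t ab) (basis ab)"
      have "L' ?e = L ?e"
        by (simp add: L'.sum L.sum L'.scale L.scale eq)
      then show ?thesis
        by (simp flip: sum_scale_basis)
    qed
    then show "L' = L" by (rule ext)
  qed
qed
lemma tensor_mult: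
  fixes p q p' q' :: "'a::monoid_add \<Rightarrow>\<^sub>0 'k::comm_ring_1"
  shows "(p \<otimes> q) * (p' \<otimes> q') = (p * p') \<otimes> (q * q')"
proof -
  have expand: "p = (\<Sum>a \<in> Poly_Mapping.keys p. Poly_Mapping.single a (Poly_Mapping.lookup p a))"
    for p :: "'a \<Rightarrow>\<^sub>0 'k"
    by (rule poly_mapping_eqI)
       (auto simp: lookup_sum lookup_single when_def in_keys_iff if_distrib cong: if_cong)
  have add_left: "(p1 + p2) \<otimes> q = p1 \<otimes> q + p2 \<otimes> q"
    and add_right: "q \<otimes> (p1 + p2) = q \<otimes> p1 + q \<otimes> p2"
    and zero: "0 \<otimes> q = 0" "q \<otimes> 0 = 0"
    for p1 p2 q :: "'a \<Rightarrow>\<^sub>0 'k"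
    by (auto intro!: poly_mapping_eqI simp: lookup_tensor lookup_add algebra_simps)
  have sum_left: "sum f A \<otimes> q = (\<Sum>x \<in> A. f x \<otimes> q)"
    and sum_right: "q \<otimes> sum f A = (\<Sum>x \<in> A. q \<otimes> f x)"
    for f :: "'a \<Rightarrow> 'a \<Rightarrow>\<^sub>0 'k" and A and q :: "'a \<Rightarrow>\<^sub>0 'k"
    by (induction A rule: infinite_finite_induct) (simp_all add: zero add_left add_right)
  have single: "Poly_Mapping.single a c \<otimes> Poly_Mapping.single b d = Poly_Mapping.single (a, b) (c * d)"
    for a b :: 'a and c d :: 'k
    by (rule poly_mapping_eqI) (auto simp: lookup_tensor lookup_single when_def split: prod.splits if_splits)
  have s1: "(Poly_Mapping.single a c \<otimes> Poly_Mapping.single b d) *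
      (Poly_Mapping.single a' c' \<otimes> Poly_Mapping.single b' d') =
      (Poly_Mapping.single a c * Poly_Mapping.single a' c') \<otimes>
      (Poly_Mapping.single b d * Poly_Mapping.single b' d')"
    for a b a' b' :: 'a and c d c' d' :: 'k
    by (simp add: single mult_single mult_ac)
  have s2: "(p \<otimes> Poly_Mapping.single b d) *
      (Poly_Mapping.single a' c' \<otimes> Poly_Mapping.single b' d') =
      (p * Poly_Mapping.single a' c') \<otimes> (Poly_Mapping.single b d * Poly_Mapping.single b' d')"
    for b a' b' :: 'a and d c' d' :: 'k
    by (subst (1 2) expand[of p])
       (simp only: sum_left sum_distrib_right s1)
  have s3: "(p \<otimes> q) * (Poly_Mapping.single a' c' \<otimes> Poly_Mapping.single b' d') =
      (p * Poly_Mapping.single a' c') \<otimes> (q * Poly_Mapping.single b' d')"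
    for a' b' :: 'a and c' d' :: 'k
    by (subst (1 2) expand[of q])
       (simp only: sum_right sum_distrib_right s2)
  have s4: "(p \<otimes> q) * (p' \<otimes> Poly_Mapping.single b' d') =
      (p * p') \<otimes> (q * Poly_Mapping.single b' d')"
    for b' :: 'a and d' :: 'k
    by (subst (1 2) expand[of p'])
       (simp only: sum_left sum_distrib_left s3)
  show ?thesis
    by (subst (1 2) expand[of q'])
       (simp only: sum_right sum_distrib_left s4)
qed


section \<open>Grafting and coproduct\<close>

definition Bplus :: "'w \<Rightarrow> ('x, 'w, 'k) H_RT \<Rightarrow> ('x, 'w, 'k::comm_ring_1) H_RT" where
  "Bplus \<omega> = lin_ext (\<lambda>F. basis [Node \<omega> F])"

primrec Delta_tree ::
    "('x \<Rightarrow> 'k) \<Rightarrow> ('w \<Rightarrow> 'k) \<Rightarrow> ('x, 'w) rtree \<Rightarrow> ('x, 'w, 'k::comm_ring_1) H_RT2" where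
  "Delta_tree mu lam (Leaf x) =
     basis [Leaf x] \<otimes> 1 + 1 \<otimes> basis [Leaf x] + scale (mu x) (1 \<otimes> 1)"
| "Delta_tree mu lam (Node \<omega> F) =
     basis [Node \<omega> F] \<otimes> 1
     + tensor_map id (Bplus \<omega>) (prod_list (map (Delta_tree mu lam) F))
     + scale (lam \<omega>) (basis F \<otimes> 1)"

definition Delta_RT ::
    "('x \<Rightarrow> 'k) \<Rightarrow> ('w \<Rightarrow> 'k) \<Rightarrow> ('x, 'w, 'k) H_RT \<Rightarrow> ('x, 'w, 'k::comm_ring_1) H_RT2" where
  "Delta_RT mu lam = lin_ext (\<lambda>F. prod_list (map (Delta_tree mu lam) F))"

lemma Bplus_basis: "Bplus \<omega> (basis F) = basis [Node \<omega> F]"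
  by (simp add: Bplus_def)

lemma Delta_RT_recursion:
  fixes mu :: "'x \<Rightarrow> 'k::comm_ring_1" and lam :: "'w \<Rightarrow> 'k"
  shows "Delta_RT mu lam 1 = 1 \<otimes> 1"
    and "Delta_RT mu lam (basis [Leaf x]) =
      basis [Leaf x] \<otimes> 1 + 1 \<otimes> basis [Leaf x] + scale (mu x) (1 \<otimes> 1)"
    and "Delta_RT mu lam (Bplus \<omega> (basis F)) =
      Bplus \<omega> (basis F) \<otimes> 1 + tensor_map id (Bplus \<omega>) (Delta_RT mu lam (basis F))
      + scale (lam \<omega>) (basis F \<otimes> 1)"
    and "Delta_RT mu lam (basis F) = prod_list (map (\<lambda>T. Delta_RT mu lam (basis [T])) F)"
proof -
  have "1 = (1 :: ('x, 'w, 'k) H_RT) \<otimes> (1 :: ('x, 'w, 'k) H_RT)"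
    by (simp add: one_H_RT tensor_basis) (simp add: basis_def zero_prod_def zero_list_def flip: single_one)
  then show "Delta_RT mu lam 1 = 1 \<otimes> 1"
    by (simp add: Delta_RT_def one_H_RT)
qed (simp_all add: Delta_RT_def Bplus_basis)


section \<open>Vertices, subforests and quotients\<close>

text \<open>
  A vertex of a forest is addressed by a nonempty list: the index of its tree, followed by the
  child indices on the path from the root of that tree. The descendants of a vertex (itself
  included) are the vertices whose addresses extend its address.
\<close>

type_synonym address = "nat list"

fun is_vertex :: "('x, 'w) forest \<Rightarrow> address \<Rightarrow> bool" where
  "is_vertex F [] \<longleftrightarrow> False"
| "is_vertex F (i # v) \<longleftrightarrow> i < length F \<and> (v = [] \<or> is_vertex (children (F ! i)) v)"

definition vertices :: "('x, 'w) forest \<Rightarrow> address set" where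
  "vertices F = {v. is_vertex F v}"

fun subtree_at :: "('x, 'w) forest \<Rightarrow> address \<Rightarrow> ('x, 'w) rtree" where
  "subtree_at F [] = undefined"
| "subtree_at F (i # v) = (if v = [] then F ! i else subtree_at (children (F ! i)) v)"

definition leaves :: "('x, 'w) forest \<Rightarrow> address set" where
  "leaves F = {v \<in> vertices F. children (subtree_at F v) = []}"

text \<open>
  A subforest is given by its set of vertices, so that distinct sets count as distinct subforests
  even if the resulting decorated forests \<open>subforest F S\<close> are equal.
\<close>

definition subforests :: "('x, 'w) forest \<Rightarrow> address set set" where
  "subforests F =
     {S. S \<subseteq> vertices F \<and> (\<forall>v \<in> S. \<forall>w \<in> vertices F. prefix v w \<longrightarrow> w \<in> S)}"

lemma finite_vertices [simp]: "finite (vertices F)"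
proof (induction "size_list size F" arbitrary: F rule: less_induct)
  case less
  have "vertices F \<subseteq> (\<Union>i<length F. insert [i] ((#) i ` vertices (children (F ! i))))"
  proof
    fix v assume "v \<in> vertices F"
    then show "v \<in> (\<Union>i<length F. insert [i] ((#) i ` vertices (children (F ! i))))"
      by (cases v) (auto simp: vertices_def)
  qed
  moreover have "finite (vertices (children (F ! i)))" if "i < length F" for i
    by (rule less) (rule size_list_children_nth[OF that])
  ultimately show ?case
    by (auto intro: finite_subset)
qed

lemma finite_subforests [simp]: "finite (subforests F)"
  by (rule finite_subset[of _ "Pow (vertices F)"]) (auto simp: subforests_def)

text \<open>
  The forests \<open>G\<close> and \<open>F/G\<close>. Both are meant for \<open>S \<in> subforests F\<close>: as \<open>S\<close> is closed under
  descendants, a vertex in \<open>S\<close> contributes its whole subtree to \<open>G\<close>, and nothing to \<open>F/G\<close>.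
  The set \<open>{v. i # v \<in> S}\<close> is the part of \<open>S\<close> strictly below the root of the \<open>i\<close>-th tree, addressed
  in the forest of children of that root.
\<close>

function subforest :: "('x, 'w) forest \<Rightarrow> address set \<Rightarrow> ('x, 'w) forest" where
  "subforest F S = concat (map (\<lambda>i.
     if [i] \<in> S then [F ! i] else subforest (children (F ! i)) {v. i # v \<in> S}) [0..<length F])"
  by auto
termination
  by (relation "measure (\<lambda>(F, S). size_list size F)") (auto intro: size_list_children_nth)

function quotient_forest :: "('x, 'w) forest \<Rightarrow> address set \<Rightarrow> ('x, 'w) forest" where
  "quotient_forest F S = concat (map (\<lambda>i.
     if [i] \<in> S then []
     else case F ! i of
       Leaf x \<Rightarrow> [Leaf x]
     | Node \<omega> F' \<Rightarrow> [Node \<omega> (quotient_forest F' {v. i # v \<in> S})]) [0..<length F])"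
  by auto
termination
proof (relation "measure (\<lambda>(F, S). size_list size F)", goal_cases)
  case (2 F S i \<omega> F')
  then show ?case
    using size_list_children_nth[of i F] by auto
qed auto

declare subforest.simps [simp del] quotient_forest.simps [simp del]


section \<open>The leaf-shift operator\<close>

text \<open>
  In the multilinear expansion of \<open>\<Phi>(F)\<close>, a term is given by the set \<open>D\<close> of those leaves of \<open>F\<close> at
  which the scalar is chosen: these leaves are deleted and the scalars are multiplied.
\<close>

primrec root_scalar :: "('x \<Rightarrow> 'k) \<Rightarrow> ('w \<Rightarrow> 'k) \<Rightarrow> ('x, 'w) rtree \<Rightarrow> 'k" where
  "root_scalar mu lam (Leaf x) = mu x"
| "root_scalar mu lam (Node \<omega> F) = lam \<omega>"

definition leaf_shift ::
    "('x \<Rightarrow> 'k) \<Rightarrow> ('w \<Rightarrow> 'k) \<Rightarrow> ('x, 'w, 'k) H_RT \<Rightarrow> ('x, 'w, 'k::comm_ring_1) H_RT" where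
  "leaf_shift mu lam = lin_ext (\<lambda>F. \<Sum>D \<in> Pow (leaves F).
     scale (\<Prod>v \<in> D. root_scalar mu lam (subtree_at F v)) (basis (quotient_forest F D)))"

end

theory Submission
  imports Defs
begin

text \<open>
  Both sides are determined by the same recursion on the forest. Descendant-closed sets of
  \<open>T F\<close> are pairs of such sets of \<open>T\<close> and of \<open>F\<close>, and the leaf shift is multiplicative,
  so the right-hand side is multiplicative under concatenation. A subforest of \<open>B\<^sup>+\<^sub>\<omega>(F)\<close> is
  either the whole tree, which gives \<open>B\<^sup>+\<^sub>\<omega>(F) \<otimes> 1\<close>, or a subforest \<open>G\<close> of \<open>F\<close> with quotient
  \<open>B\<^sup>+\<^sub>\<omega>(F/G)\<close>. The leaf shift commutes with \<open>B\<^sup>+\<^sub>\<omega>\<close> except at the empty forest, where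
  the root itself is a leaf; this happens only for \<open>G = F\<close> and accounts for the term
  \<open>\<lambda>\<^sub>\<omega> F \<otimes> 1\<close>.
\<close>

section \<open>Linear maps and tensors\<close>

lemma scale_basis: "scale c (basis a) = Poly_Mapping.single a c"
  by (rule poly_mapping_eqI) (simp add: basis_def lookup_single when_def)

lemma tensor_add_right: "p \<otimes> (q + r) = p \<otimes> q + p \<otimes> r"
  by (rule poly_mapping_eqI) (auto simp: lookup_tensor lookup_add algebra_simps)

lemma tensor_scale_left: "scale c p \<otimes> q = scale c (p \<otimes> q)"
  by (rule poly_mapping_eqI) (auto simp: lookup_tensor algebra_simps)

lemma tensor_scale_right: "p \<otimes> scale c q = scale c (p \<otimes> q)"
  by (rule poly_mapping_eqI) (auto simp: lookup_tensor algebra_simps)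

lemma tensor_sum_left: "sum f A \<otimes> q = (\<Sum>x\<in>A. f x \<otimes> q)"
  by (rule poly_mapping_eqI) (auto simp: lookup_tensor lookup_sum sum_distrib_right)

lemma tensor_sum_right: "q \<otimes> sum f A = (\<Sum>x\<in>A. q \<otimes> f x)"
  by (rule poly_mapping_eqI) (auto simp: lookup_tensor lookup_sum sum_distrib_left)

lemma tensor_map_module_hom: "module_hom scale scale (tensor_map f g)"
  unfolding tensor_map_def by (rule lin_ext_module_hom)

lemma Bplus_module_hom: "module_hom scale scale (Bplus \<omega>)"
  unfolding Bplus_def by (rule lin_ext_module_hom)

lemma module_hom_id_scale: "module_hom scale scale (id :: ('a \<Rightarrow>\<^sub>0 'k::comm_ring_1) \<Rightarrow> _)"
  by (simp add: module_hom_iff module_scale)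

text \<open>\<open>tensor_map\<close> is fixed by its values on pairs of basis elements only.
  Expanding first \<open>q\<close> and then \<open>p\<close> in the basis carries the formula to all
  pure tensors, which is where linearity of \<open>f\<close> and \<open>g\<close> enters.\<close>

lemma tensor_map_tensor:
  fixes p :: "'a \<Rightarrow>\<^sub>0 'k::comm_ring_1" and q :: "'b \<Rightarrow>\<^sub>0 'k"
  assumes "module_hom scale scale f" and "module_hom scale scale g"
  shows "tensor_map f g (p \<otimes> q) = f p \<otimes> g q"
proof -
  interpret f: module_hom scale scale f by fact
  interpret g: module_hom scale scale g by fact
  interpret t: module_hom scale scale "tensor_map f g" by (rule tensor_map_module_hom)
  have basis: "tensor_map f g (basis a \<otimes> basis b) = f (basis a) \<otimes> g (basis b)" for a b
    by (simp add: tensor_basis) (simp add: tensor_map_def)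
  have "tensor_map f g (basis a \<otimes> q) = f (basis a) \<otimes> g q" for a
    by (subst (1 2) sum_scale_basis[of q])
       (simp only: tensor_sum_right tensor_scale_right t.sum t.scale g.sum g.scale basis)
  then show ?thesis
    by (subst (1 2) sum_scale_basis[of p])
       (simp only: tensor_sum_left tensor_scale_left t.sum t.scale f.sum f.scale)
qed

lemma scale_one: "scale c (1 :: ('x, 'w, 'k::comm_ring_1) H_RT) = Poly_Mapping.single [] c"
  by (simp add: one_H_RT scale_basis)

lemma tensor_one_one: "(1 :: ('x, 'w, 'k::comm_ring_1) H_RT) \<otimes> (1 :: ('x, 'w, 'k) H_RT) = 1"
  by (simp add: one_H_RT tensor_basis)
     (simp add: basis_def zero_prod_def zero_list_def flip: single_one)


section \<open>Addresses in a concatenation and in a grafting\<close>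

text \<open>Putting a tree in front of a forest moves every tree index up by one and leaves the rest
  of the address alone. The value at \<open>[]\<close>, which is no vertex, keeps the map injective
  and prefix-preserving on all lists.\<close>

fun raise :: "address \<Rightarrow> address" where
  "raise [] = []"
| "raise (i # v) = Suc i # v"

lemma inj_raise: "inj raise"
proof (rule injI)
  fix v w assume "raise v = raise w"
  then show "v = w" by (cases v; cases w) auto
qed

lemma Cons_in_raise_image [simp]:
  "0 # v \<notin> raise ` S" "Suc i # v \<in> raise ` S \<longleftrightarrow> i # v \<in> S"
proof -
  have "0 # v \<noteq> raise w" for w by (cases w) auto
  then show "0 # v \<notin> raise ` S" by auto
  have "Suc i # v = raise (i # v)" by simp
  then show "Suc i # v \<in> raise ` S \<longleftrightarrow> i # v \<in> S"
    using inj_raise by (metis inj_image_mem_iff)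
qed

lemma is_vertex_raise [simp]: "is_vertex (T # F) (raise v) \<longleftrightarrow> is_vertex F v"
  by (cases v) auto

lemma prefix_raise [simp]: "prefix (raise v) (raise w) \<longleftrightarrow> prefix v w"
  by (cases v; cases w) auto

lemma subtree_at_raise: "v \<noteq> [] \<Longrightarrow> subtree_at (T # F) (raise v) = subtree_at F v"
  by (cases v) auto

lemma is_vertex_singleton_iff:
  "is_vertex [T] v \<longleftrightarrow> v = [0] \<or> (\<exists>u. v = 0 # u \<and> is_vertex (children T) u)"
  by (cases v) auto

lemma vertices_Nil [simp]: "vertices ([] :: ('x, 'w) forest) = {}"
proof -
  have "\<not> is_vertex ([] :: ('x, 'w) forest) v" for v
    by (cases v) auto
  then show ?thesis by (simp add: vertices_def)
qed

lemma vertices_singleton: "vertices [T] = insert [0] ((#) 0 ` vertices (children T))"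
  by (auto simp: vertices_def is_vertex_singleton_iff)

lemma Nil_notin_vertices [simp]: "[] \<notin> vertices F"
  by (simp add: vertices_def)

lemma vertices_Cons: "vertices (T # F) = vertices [T] \<union> raise ` vertices F"
proof (rule set_eqI)
  fix v
  show "v \<in> vertices (T # F) \<longleftrightarrow> v \<in> vertices [T] \<union> raise ` vertices F"
  proof (cases v)
    case Nil
    have "[] \<notin> raise ` vertices F"
      using inj_image_mem_iff[OF inj_raise, of "[]"] by simp
    then show ?thesis using Nil by simp
  next
    case (Cons i u)
    then show ?thesis by (cases i) (auto simp: vertices_def)
  qed
qed

lemma raise_notin_vertices_singleton [simp]: "raise v \<notin> vertices [T]"
  by (cases v) (auto simp: vertices_singleton)

section \<open>Sets of vertices of \<open>T # F\<close> as pairs of sets\<close>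

lemma raise_image_disjoint: "A \<subseteq> vertices [T] \<Longrightarrow> A \<inter> raise ` B = {}"
  by auto

lemma split_raise_union:
  assumes "A \<subseteq> vertices [T]"
  shows "(A \<union> raise ` B) \<inter> vertices [T] = A" "raise -` (A \<union> raise ` B) = B"
proof -
  show "(A \<union> raise ` B) \<inter> vertices [T] = A" using assms by auto
  have "raise -` A = {}" using assms by auto
  then show "raise -` (A \<union> raise ` B) = B"
    by (simp add: inj_vimage_image_eq[OF inj_raise])
qed

lemma join_raise_split:
  "S \<subseteq> vertices (T # F) \<Longrightarrow> (S \<inter> vertices [T]) \<union> raise ` (raise -` S) = S"
  by (auto simp: vertices_Cons[of T F])

text \<open>Any family of vertex sets that is stable under joining and splitting factors as a
  product. The families are left abstract because the lemma serves both the subforests and the sets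
  of deleted leaves.\<close>

lemma bij_betw_raise_union:
  assumes "\<And>A. A \<in> \<A> \<Longrightarrow> A \<subseteq> vertices [T]"
    and "\<And>S. S \<in> \<S> \<Longrightarrow> S \<subseteq> vertices (T # F)"
    and "\<And>A B. A \<in> \<A> \<Longrightarrow> B \<in> \<B> \<Longrightarrow> A \<union> raise ` B \<in> \<S>"
    and "\<And>S. S \<in> \<S> \<Longrightarrow> S \<inter> vertices [T] \<in> \<A>"
    and "\<And>S. S \<in> \<S> \<Longrightarrow> raise -` S \<in> \<B>"
  shows "bij_betw (\<lambda>(A, B). A \<union> raise ` B) (\<A> \<times> \<B>) \<S>"
proof (rule bij_betw_byWitness[where f' = "\<lambda>S. (S \<inter> vertices [T], raise -` S)"])
  show "\<forall>S\<in>\<S>. (case (S \<inter> vertices [T], raise -` S) of (A, B) \<Rightarrow> A \<union> raise ` B) = S"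
    by (intro ballI) (simp only: prod.case join_raise_split[OF assms(2)])
  show "\<forall>a\<in>\<A> \<times> \<B>. ((case a of (A, B) \<Rightarrow> A \<union> raise ` B) \<inter> vertices [T],
      raise -` (case a of (A, B) \<Rightarrow> A \<union> raise ` B)) = a"
    by (intro ballI, elim SigmaE) (simp only: prod.case split_raise_union[OF assms(1)])
qed (use assms(3-5) in auto)

text \<open>Extending a nonempty address keeps its first index, so descent never crosses from
  \<open>T\<close> to \<open>F\<close>. The next lemma is the same fact in the other direction;
  together they let closure under descendants be checked on each side separately.\<close>

lemma prefix_vertices_singleton:
  assumes "v \<in> vertices [T]" "prefix v w" "w \<in> vertices (T # F)"
  shows "w \<in> vertices [T]"
  using assms by (cases v; cases w) (auto simp: vertices_def)

lemma not_prefix_raise: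
  assumes "v \<in> vertices F" "w \<in> vertices [T]"
  shows "\<not> prefix (raise v) w"
  using assms by (cases v; cases w) (auto simp: vertices_def)

lemma subforestsD: "S \<in> subforests F \<Longrightarrow> S \<subseteq> vertices F"
  by (simp add: subforests_def)

lemma raise_union_in_subforests:
  assumes "A \<in> subforests [T]" "B \<in> subforests F"
  shows "A \<union> raise ` B \<in> subforests (T # F)"
proof -
  have "w \<in> A \<union> raise ` B"
    if v: "v \<in> A \<union> raise ` B" and w: "w \<in> vertices (T # F)" and "prefix v w" for v w
  proof (cases "v \<in> A")
    case True
    then have "w \<in> vertices [T]"
      using prefix_vertices_singleton[of v T w F] that subforestsD[OF assms(1)] by blast
    then show ?thesis using True assms(1) \<open>prefix v w\<close> by (auto simp: subforests_def)
  next
    case False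
    then obtain u where u: "u \<in> B" "v = raise u" using v by blast
    then have "w \<notin> vertices [T]"
      using not_prefix_raise subforestsD[OF assms(2)] \<open>prefix v w\<close> by blast
    then obtain w' where "w' \<in> vertices F" "w = raise w'"
      using w by (auto simp: vertices_Cons[of T F])
    then show ?thesis using u assms(2) \<open>prefix v w\<close> by (auto simp: subforests_def)
  qed
  then show ?thesis
    using assms[THEN subforestsD] unfolding subforests_def vertices_Cons[of T F] by blast
qed

lemma split_in_subforests:
  assumes "S \<in> subforests (T # F)"
  shows "S \<inter> vertices [T] \<in> subforests [T]" "raise -` S \<in> subforests F"
proof -
  show "S \<inter> vertices [T] \<in> subforests [T]"
    using assms by (auto simp: subforests_def vertices_Cons[of T F])
  have "raise -` S \<subseteq> vertices F"
    using assms by (auto simp: subforests_def vertices_def)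
  moreover have "raise w \<in> S" if "raise v \<in> S" "w \<in> vertices F" "prefix v w" for v w
  proof -
    have "raise w \<in> vertices (T # F)" "prefix (raise v) (raise w)"
      using that by (auto simp: vertices_def)
    then show ?thesis using assms that(1) unfolding subforests_def by blast
  qed
  ultimately show "raise -` S \<in> subforests F"
    by (auto simp: subforests_def)
qed

lemma bij_betw_subforests_Cons:
  "bij_betw (\<lambda>(A, B). A \<union> raise ` B) (subforests [T] \<times> subforests F) (subforests (T # F))"
  by (rule bij_betw_raise_union)
     (auto dest: subforestsD intro: raise_union_in_subforests split_in_subforests)

section \<open>Leaves of a concatenation\<close>

lemma leaves_subset: "leaves F \<subseteq> vertices F"
  by (auto simp: leaves_def)

lemma finite_leaves: "finite (leaves F)"
  using finite_subset[OF leaves_subset] by simp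

lemma leaves_Cons: "leaves (T # F) = leaves [T] \<union> raise ` leaves F"
proof -
  have "subtree_at (T # F) v = subtree_at [T] v" if "v \<in> vertices [T]" for v
    using that by (auto simp: vertices_singleton)
  moreover have "subtree_at (T # F) (raise v) = subtree_at F v" if "v \<in> vertices F" for v
    using that by (intro subtree_at_raise) auto
  ultimately show ?thesis
    by (auto simp: leaves_def vertices_Cons[of T F])
qed

lemma bij_betw_Pow_leaves_Cons:
  "bij_betw (\<lambda>(A, B). A \<union> raise ` B) (Pow (leaves [T]) \<times> Pow (leaves F)) (Pow (leaves (T # F)))"
proof (rule bij_betw_raise_union)
  have "leaves (T # F) \<inter> vertices [T] = leaves [T]" "raise -` leaves (T # F) = leaves F"
    unfolding leaves_Cons[of T F] by (rule split_raise_union[OF leaves_subset])+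
  then show "\<And>S. S \<in> Pow (leaves (T # F)) \<Longrightarrow> S \<inter> vertices [T] \<in> Pow (leaves [T])"
    "\<And>S. S \<in> Pow (leaves (T # F)) \<Longrightarrow> raise -` S \<in> Pow (leaves F)"
    by blast+
qed (use leaves_subset leaves_Cons[of T F] in blast)+

text \<open>Every vertex extends \<open>[0]\<close>, so a closed set containing the root is
  everything. If the root is missing, all addresses of the set have the form \<open>0 # u\<close>,
  and stripping the \<open>0\<close> yields a subforest of \<open>F\<close>.\<close>

lemma subforests_Node:
  "subforests [Node \<omega> F] = insert (vertices [Node \<omega> F]) ((`) ((#) 0) ` subforests F)"
proof (intro equalityI subsetI)
  fix S assume S: "S \<in> subforests [Node \<omega> F]"
  show "S \<in> insert (vertices [Node \<omega> F]) ((`) ((#) 0) ` subforests F)"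
  proof (cases "[0] \<in> S")
    case True
    then have "vertices [Node \<omega> F] \<subseteq> S"
      using S by (auto simp: subforests_def vertices_singleton)
    then show ?thesis using subforestsD[OF S] by blast
  next
    case False
    then have "S = (#) 0 ` ((#) 0 -` S)"
      using subforestsD[OF S] by (auto simp: vertices_singleton)
    moreover have "(#) 0 -` S \<in> subforests F"
      using S False by (auto simp: subforests_def vertices_singleton)
    ultimately show ?thesis by blast
  qed
qed (auto simp: subforests_def vertices_singleton)

text \<open>The case split is the source of the \<open>lam\<close> term in the coproduct: the root
  is itself subject to the leaf shift exactly when nothing hangs below it.\<close>

lemma leaves_Node:
  "leaves [Node \<omega> F] = (if F = [] then {[0]} else (#) 0 ` leaves F)"
proof -
  have "subtree_at [Node \<omega> F] (0 # v) = subtree_at F v" if "v \<in> vertices F" for v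
    using that by auto
  then show ?thesis
    by (auto simp: leaves_def vertices_singleton simp del: subtree_at.simps(2)) simp_all
qed

lemma leaves_Leaf: "leaves [Leaf x] = {[0]}"
  by (auto simp: leaves_def vertices_singleton)


section \<open>Subforests and quotients\<close>

lemma subforest_Nil [simp]: "subforest [] S = []"
  by (simp add: subforest.simps)

lemma quotient_forest_Nil [simp]: "quotient_forest [] S = []"
  by (simp add: quotient_forest.simps)

lemma subforest_singleton:
  "subforest [T] S = (if [0] \<in> S then [T] else subforest (children T) {v. 0 # v \<in> S})"
  by (simp add: subforest.simps[of "[T]"])

lemma quotient_forest_singleton:
  "quotient_forest [Leaf x] S = (if [0] \<in> S then [] else [Leaf x])"
  "quotient_forest [Node \<omega> F] S =
    (if [0] \<in> S then [] else [Node \<omega> (quotient_forest F {v. 0 # v \<in> S})])"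
  by (simp_all add: quotient_forest.simps[of "[_]"])

text \<open>Peels off the first tree; the shift \<open>Suc i\<close> left on the other indices is
  the one that \<open>raise\<close> performs on addresses.\<close>

lemma concat_map_upt_Suc:
  "concat (map f [0..<Suc n]) = f 0 @ concat (map (\<lambda>i. f (Suc i)) [0..<n])"
  by (simp only: map_upt_Suc concat.simps)

lemma subforest_Cons:
  assumes "A \<subseteq> vertices [T]"
  shows "subforest (T # F) (A \<union> raise ` B) = subforest [T] A @ subforest F B"
proof -
  have "Suc i # v \<notin> A" for i v using assms by (auto simp: vertices_singleton)
  then show ?thesis
    by (subst (1 3) subforest.simps, subst length_Cons, subst concat_map_upt_Suc)
       (simp add: subforest_singleton cong: if_cong)
qed

text \<open>At index \<open>0\<close> only \<open>A\<close> is visible and at \<open>Suc i\<close>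
  only \<open>B\<close>. The statement is about sets of vertices in general, so it covers both
  quotients by subforests and deletions of leaves in the leaf shift.\<close>

lemma quotient_forest_Cons:
  assumes "A \<subseteq> vertices [T]"
  shows "quotient_forest (T # F) (A \<union> raise ` B) = quotient_forest [T] A @ quotient_forest F B"
proof -
  have "Suc i # v \<notin> A" for i v using assms by (auto simp: vertices_singleton)
  then show ?thesis
    by (subst (1 3) quotient_forest.simps, subst length_Cons, subst concat_map_upt_Suc)
       (cases T; simp add: quotient_forest_singleton cong: if_cong rtree.case_cong)
qed

lemma subforest_vertices: "subforest F (vertices F) = F"
proof -
  have "subforest F (vertices F) = concat (map (\<lambda>i. [F ! i]) [0..<length F])"
    by (subst subforest.simps, rule arg_cong[of _ _ concat], rule map_cong)
       (auto simp: vertices_def)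
  also have "\<dots> = F"
    by (simp add: concat_map_singleton map_nth)
  finally show ?thesis .
qed

text \<open>Each root outside \<open>S\<close> survives as the root of a tree, so an empty quotient
  means that all roots lie in \<open>S\<close>, and closure under descendants then gives every
  vertex. This singles out the one subforest whose quotient carries the \<open>lam\<close>
  term.\<close>

lemma quotient_forest_eq_Nil_iff:
  assumes "S \<in> subforests F"
  shows "quotient_forest F S = [] \<longleftrightarrow> S = vertices F"
proof -
  have concat_Nil: "concat (map f [0..<n]) = [] \<longleftrightarrow> (\<forall>i<n. f i = [])"
    for f :: "nat \<Rightarrow> 'c list" and n
    by auto
  have "quotient_forest F S = [] \<longleftrightarrow> (\<forall>i<length F. [i] \<in> S)"
    by (subst quotient_forest.simps, subst concat_Nil) (simp split: rtree.split, metis rtree.exhaust)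
  also have "\<dots> \<longleftrightarrow> S = vertices F"
  proof
    assume roots: "\<forall>i<length F. [i] \<in> S"
    have "v \<in> S" if "v \<in> vertices F" for v
    proof (cases v)
      case (Cons i u)
      then have "[i] \<in> S" "prefix [i] v" using that roots by (auto simp: vertices_def)
      then show ?thesis using assms that unfolding subforests_def by blast
    qed (use that in simp)
    then show "S = vertices F" using subforestsD[OF assms] by blast
  qed (auto simp: vertices_def)
  finally show ?thesis .
qed


section \<open>The leaf shift\<close>

text \<open>Absorbing the scalar into \<open>single\<close> lets a product of two terms be computed
  by \<open>mult_single\<close>, which multiplies scalars and concatenates forests at once.\<close>

lemma leaf_shift_basis:
  "leaf_shift mu lam (basis F) = (\<Sum>D \<in> Pow (leaves F).
    Poly_Mapping.single (quotient_forest F D) (\<Prod>v \<in> D. root_scalar mu lam (subtree_at F v)))"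
  by (simp add: leaf_shift_def scale_basis)

lemma leaf_shift_Nil: "leaf_shift mu lam (basis []) = 1"
  by (simp add: leaf_shift_basis leaves_def) (simp add: one_H_RT basis_def)

lemma leaf_shift_Cons:
  "leaf_shift mu lam (basis (T # F)) =
    leaf_shift mu lam (basis [T]) * leaf_shift mu lam (basis F)"
proof -
  let ?c = "\<lambda>F D. \<Prod>v \<in> D. root_scalar mu lam (subtree_at F v)"
  let ?q = quotient_forest
  have term_eq: "Poly_Mapping.single (?q (T # F) (A \<union> raise ` B)) (?c (T # F) (A \<union> raise ` B)) =
      Poly_Mapping.single (?q [T] A) (?c [T] A) * Poly_Mapping.single (?q F B) (?c F B)"
    if A: "A \<subseteq> leaves [T]" and B: "B \<subseteq> leaves F" for A B
  proof -
    have A': "A \<subseteq> vertices [T]" and B': "B \<subseteq> vertices F"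
      using A B leaves_subset by blast+
    have "finite A" "finite B"
      using A B finite_leaves finite_subset by blast+
    then have "?c (T # F) (A \<union> raise ` B) = ?c (T # F) A * ?c (T # F) (raise ` B)"
      using raise_image_disjoint[OF A'] by (intro prod.union_disjoint) auto
    also have "?c (T # F) A = ?c [T] A"
      using A' by (intro prod.cong refl) (auto simp: vertices_singleton)
    also have "?c (T # F) (raise ` B) = ?c F B"
    proof (subst prod.reindex)
      show "inj_on raise B" using inj_raise by (rule inj_on_subset) simp
      have "v \<noteq> []" if "v \<in> B" for v using that B' by auto
      then show "prod ((\<lambda>v. root_scalar mu lam (subtree_at (T # F) v)) \<circ> raise) B = ?c F B"
        by (intro prod.cong refl) (simp add: subtree_at_raise)
    qed
    finally show ?thesis
      by (simp add: quotient_forest_Cons[OF A'] mult_single plus_list_def)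
  qed
  have "leaf_shift mu lam (basis (T # F)) =
      (\<Sum>(A, B) \<in> Pow (leaves [T]) \<times> Pow (leaves F).
        Poly_Mapping.single (?q (T # F) (A \<union> raise ` B)) (?c (T # F) (A \<union> raise ` B)))"
    unfolding leaf_shift_basis
    by (subst sum.reindex_bij_betw[OF bij_betw_Pow_leaves_Cons, symmetric])
       (simp add: case_prod_unfold)
  also have "\<dots> = (\<Sum>(A, B) \<in> Pow (leaves [T]) \<times> Pow (leaves F).
        Poly_Mapping.single (?q [T] A) (?c [T] A) * Poly_Mapping.single (?q F B) (?c F B))"
    by (intro sum.cong refl) (auto simp: term_eq)
  also have "\<dots> = leaf_shift mu lam (basis [T]) * leaf_shift mu lam (basis F)"
    by (simp add: leaf_shift_basis sum_product sum.cartesian_product)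
  finally show ?thesis .
qed

text \<open>The quotient of a one-tree forest may be empty, so the recursion for subforests needs
  multiplicativity for arbitrary forests and not just for a leading tree.\<close>

lemma leaf_shift_append:
  "leaf_shift mu lam (basis (F @ G)) = leaf_shift mu lam (basis F) * leaf_shift mu lam (basis G)"
proof (induction F)
  case (Cons T F)
  have "leaf_shift mu lam (basis ((T # F) @ G)) =
      leaf_shift mu lam (basis [T]) * leaf_shift mu lam (basis (F @ G))"
    using leaf_shift_Cons[of mu lam T "F @ G"] by simp
  then show ?case
    by (simp add: Cons.IH leaf_shift_Cons[of mu lam T F] mult.assoc)
qed (simp add: leaf_shift_Nil)

lemma Pow_singleton: "Pow {a} = {{}, {a}}"
  by auto

lemma leaf_shift_Leaf: "leaf_shift mu lam (basis [Leaf x]) = basis [Leaf x] + scale (mu x) 1"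
  by (simp add: leaf_shift_basis leaves_Leaf Pow_singleton quotient_forest_singleton
      scale_one) (simp add: basis_def)

lemma leaf_shift_Node_Nil:
  "leaf_shift mu lam (basis [Node \<omega> []]) = basis [Node \<omega> []] + scale (lam \<omega>) 1"
  by (simp add: leaf_shift_basis leaves_Node Pow_singleton quotient_forest_singleton
      scale_one) (simp add: basis_def)

text \<open>With \<open>F\<close> nonempty the root is not a leaf, so it survives every deletion and
  the expansion takes place entirely below it.\<close>

lemma leaf_shift_Node:
  assumes "F \<noteq> []"
  shows "leaf_shift mu lam (basis [Node \<omega> F]) = Bplus \<omega> (leaf_shift mu lam (basis F))"
proof -
  interpret B: module_hom scale scale "Bplus \<omega>" by (rule Bplus_module_hom)
  let ?c = "\<lambda>F D. \<Prod>v \<in> D. root_scalar mu lam (subtree_at F v)"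
  have c: "?c [Node \<omega> F] ((#) 0 ` D) = ?c F D" if "D \<subseteq> leaves F" for D
  proof -
    \<comment> \<open>Prefixing \<open>[]\<close> with \<open>0\<close> would give the address of
      the root, whose scalar has no counterpart in \<open>F\<close>.\<close>
    have "[] \<notin> D" using that leaves_subset Nil_notin_vertices by blast
    then show ?thesis
      by (subst prod.reindex) (auto simp: inj_on_def intro!: prod.cong)
  qed
  have "leaf_shift mu lam (basis [Node \<omega> F]) = (\<Sum>D \<in> Pow ((#) 0 ` leaves F).
      Poly_Mapping.single (quotient_forest [Node \<omega> F] D) (?c [Node \<omega> F] D))"
    using assms by (simp add: leaf_shift_basis leaves_Node)
  also have "\<dots> = (\<Sum>D \<in> Pow (leaves F).
      Poly_Mapping.single (quotient_forest [Node \<omega> F] ((#) 0 ` D)) (?c [Node \<omega> F] ((#) 0 ` D)))"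
    by (subst sum.reindex_bij_betw[OF bij_betw_Pow, symmetric,
          where f = "(#) 0" and A = "leaves F"])
       (auto simp: bij_betw_def)
  also have "\<dots> = (\<Sum>D \<in> Pow (leaves F). scale (?c F D) (basis [Node \<omega> (quotient_forest F D)]))"
  proof (intro sum.cong refl)
    fix D assume "D \<in> Pow (leaves F)"
    moreover from this have "[] \<notin> D" using leaves_subset Nil_notin_vertices by blast
    ultimately show "Poly_Mapping.single (quotient_forest [Node \<omega> F] ((#) 0 ` D))
          (?c [Node \<omega> F] ((#) 0 ` D)) =
        scale (?c F D) (basis [Node \<omega> (quotient_forest F D)])"
      using c[of D] by (simp add: quotient_forest_singleton scale_basis image_iff)
  qed
  also have "\<dots> = Bplus \<omega> (leaf_shift mu lam (basis F))"
    by (simp add: leaf_shift_def B.sum B.scale Bplus_basis)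
  finally show ?thesis .
qed


section \<open>The coproduct\<close>

text \<open>The right-hand side of the theorem gets a name so that it can be shown to satisfy the
  recursion defining \<open>Delta_tree\<close>.\<close>

definition cut_sum ::
    "('x \<Rightarrow> 'k) \<Rightarrow> ('w \<Rightarrow> 'k) \<Rightarrow> ('x, 'w) forest \<Rightarrow> ('x, 'w, 'k::comm_ring_1) H_RT2" where
  "cut_sum mu lam F =
    (\<Sum>G \<in> subforests F. basis (subforest F G) \<otimes> leaf_shift mu lam (basis (quotient_forest F G)))"

lemma cut_sum_Nil: "cut_sum mu lam ([] :: ('a, 'b) forest) = 1"
proof -
  have "subforests ([] :: ('a, 'b) forest) = {{}}" by (auto simp: subforests_def)
  then show ?thesis
    by (simp add: cut_sum_def leaf_shift_Nil) (simp add: tensor_one_one flip: one_H_RT)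
qed

text \<open>Reindexing by pairs of subforests turns each term into a product: subforests and
  quotients concatenate, the leaf shift is multiplicative, and \<open>tensor_mult\<close> separates
  the two pairs of factors.\<close>

lemma cut_sum_Cons: "cut_sum mu lam (T # F) = cut_sum mu lam [T] * cut_sum mu lam F"
proof -
  let ?t = "\<lambda>F G. basis (subforest F G) \<otimes> leaf_shift mu lam (basis (quotient_forest F G))"
  have "cut_sum mu lam (T # F) =
      (\<Sum>(A, B) \<in> subforests [T] \<times> subforests F. ?t (T # F) (A \<union> raise ` B))"
    unfolding cut_sum_def
    by (subst sum.reindex_bij_betw[OF bij_betw_subforests_Cons, symmetric])
       (simp add: case_prod_unfold)
  also have "\<dots> = (\<Sum>(A, B) \<in> subforests [T] \<times> subforests F. ?t [T] A * ?t F B)"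
    by (intro sum.cong refl)
       (auto simp: subforest_Cons quotient_forest_Cons leaf_shift_append tensor_mult basis_mult
         dest!: subforestsD)
  also have "\<dots> = cut_sum mu lam [T] * cut_sum mu lam F"
    by (simp add: cut_sum_def sum_product sum.cartesian_product)
  finally show ?thesis .
qed

lemma cut_sum_Leaf:
  "cut_sum mu lam [Leaf x :: ('a, 'b) rtree] = Delta_tree mu lam (Leaf x)"
proof -
  have "subforests [Leaf x :: ('a, 'b) rtree] = {{}, {[0]}}"
    by (auto simp: subforests_def vertices_singleton)
  then show ?thesis
    by (simp add: cut_sum_def subforest_singleton quotient_forest_singleton leaf_shift_Leaf
        leaf_shift_Nil tensor_add_right tensor_scale_right)
       (simp add: add.assoc add.commute flip: one_H_RT)
qed

lemma cut_sum_Node: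
  "cut_sum mu lam [Node \<omega> F] = basis [Node \<omega> F] \<otimes> 1
     + tensor_map id (Bplus \<omega>) (cut_sum mu lam F) + scale (lam \<omega>) (basis F \<otimes> 1)"
proof -
  interpret t: module_hom scale scale "tensor_map id (Bplus \<omega>)" by (rule tensor_map_module_hom)
  let ?T = "[Node \<omega> F]"
  let ?q = "quotient_forest F"
  let ?t = "\<lambda>F G. basis (subforest F G) \<otimes> leaf_shift mu lam (basis (quotient_forest F G))"
  have top: "?t ?T (vertices ?T) = basis ?T \<otimes> 1"
    by (simp add: subforest_vertices) (simp add: quotient_forest_singleton vertices_singleton
        leaf_shift_Nil)
  \<comment> \<open>One formula for all subforests avoiding the root: the grafted term plus a
    correction supported at the single set \<open>vertices F\<close>, which \<open>sum.delta\<close>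
    later extracts.\<close>
  have below: "?t ?T ((#) 0 ` G) = basis (subforest F G) \<otimes> Bplus \<omega> (leaf_shift mu lam (basis (?q G)))
      + (if G = vertices F then scale (lam \<omega>) (basis F \<otimes> 1) else 0)"
    if G: "G \<in> subforests F" for G
  proof -
    have "[] \<notin> G" using subforestsD[OF G] by auto
    then have cut: "?t ?T ((#) 0 ` G) =
        basis (subforest F G) \<otimes> leaf_shift mu lam (basis [Node \<omega> (?q G)])"
      by (simp add: subforest_singleton quotient_forest_singleton image_iff)
    show ?thesis
    proof (cases "G = vertices F")
      case True
      then have "?q G = []" using quotient_forest_eq_Nil_iff[OF G] by simp
      then show ?thesis
        \<comment> \<open>Here the quotient is the bare root; its shift splits into
          \<open>Bplus \<omega> 1\<close> and the scalar, giving the regular term and the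
          correction.\<close>
        unfolding cut using True
        by (simp add: leaf_shift_Node_Nil leaf_shift_Nil tensor_add_right tensor_scale_right
            subforest_vertices one_H_RT Bplus_basis)
    next
      case False
      then have "?q G \<noteq> []" using quotient_forest_eq_Nil_iff[OF G] by simp
      then show ?thesis unfolding cut using False by (simp add: leaf_shift_Node)
    qed
  qed
  \<comment> \<open>The whole tree contains the root \<open>[0]\<close>, while no image
    \<open>0 # u\<close> with \<open>u\<close> a vertex of \<open>F\<close> does; hence the top term
    is separate from the others in the sum.\<close>
  have "vertices ?T \<notin> (`) ((#) 0) ` subforests F"
  proof
    assume "vertices ?T \<in> (`) ((#) 0) ` subforests F"
    then obtain G where G: "G \<in> subforests F" and eq: "vertices ?T = (#) 0 ` G" by blast
    have "[0] \<in> vertices ?T" by (simp add: vertices_singleton)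
    then have "[] \<in> G" unfolding eq by auto
    then show False using subforestsD[OF G] by auto
  qed
  moreover have "inj_on ((`) ((#) 0)) (subforests F)"
    by (auto simp: inj_on_def inj_image_eq_iff)
  ultimately have "cut_sum mu lam ?T =
      ?t ?T (vertices ?T) + (\<Sum>G \<in> subforests F. ?t ?T ((#) 0 ` G))"
    unfolding cut_sum_def subforests_Node by (simp add: sum.reindex)
  also have "(\<Sum>G \<in> subforests F. ?t ?T ((#) 0 ` G)) =
      (\<Sum>G \<in> subforests F. basis (subforest F G) \<otimes> Bplus \<omega> (leaf_shift mu lam (basis (?q G))))
      + scale (lam \<omega>) (basis F \<otimes> 1)"
  proof -
    have "vertices F \<in> subforests F" by (auto simp: subforests_def)
    then show ?thesis by (simp add: below sum.distrib sum.delta)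
  qed
  also have "(\<Sum>G \<in> subforests F.
        basis (subforest F G) \<otimes> Bplus \<omega> (leaf_shift mu lam (basis (?q G)))) =
      tensor_map id (Bplus \<omega>) (cut_sum mu lam F)"
    by (simp add: cut_sum_def t.sum tensor_map_tensor[OF module_hom_id_scale Bplus_module_hom])
  finally show ?thesis unfolding top by (simp add: add.assoc)
qed

lemma prod_list_cut_sum: "prod_list (map (\<lambda>T. cut_sum mu lam [T]) F) = cut_sum mu lam F"
proof (induction F)
  case (Cons T F)
  then show ?case by (simp add: cut_sum_Cons[of mu lam T F])
qed (simp add: cut_sum_Nil)

text \<open>Stated as an equality of functions because \<open>Delta_tree mu lam\<close> occurs
  unapplied, under \<open>map\<close>, in the definition of \<open>Delta_RT\<close>.\<close>

lemma Delta_tree_eq_cut_sum: "Delta_tree mu lam = (\<lambda>T. cut_sum mu lam [T])"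
proof
  fix T
  show "Delta_tree mu lam T = cut_sum mu lam [T]"
  proof (induction T)
    case (Node \<omega> F)
    then have "map (Delta_tree mu lam) F = map (\<lambda>T. cut_sum mu lam [T]) F" by simp
    then show ?case by (simp only: Delta_tree.simps cut_sum_Node prod_list_cut_sum)
  qed (simp only: cut_sum_Leaf)
qed

theorem theorem2p8:
  fixes X :: "'x set" and \<Omega> :: "'w set"
    and mu :: "'x \<Rightarrow> 'k::comm_ring_1" and lam :: "'w \<Rightarrow> 'k"
    and F :: "('x, 'w) forest"
  assumes "\<Omega> \<noteq> {}"
    and "F \<in> F_RT X \<Omega>"
  shows "Delta_RT mu lam (basis F) =
    (\<Sum>G \<in> subforests F. basis (subforest F G) \<otimes> leaf_shift mu lam (basis (quotient_forest F G)))"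
  by (simp add: Delta_RT_def Delta_tree_eq_cut_sum prod_list_cut_sum flip: cut_sum_def)

end
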